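(* For every integer $n \geq 3$, the digraph $\overrightarrow{K_n}$ is antimagic.
   Context: For $n\ge 2$, $\overrightarrow{K_n}$ is the directed graph with vertex set $\{v_1,\dots,v_n\}$ having, for every pair $1\le i<j\le n$, exactly one arc, directed from $v_i$ to $v_j$; it has $l=\binom{n}{2}$ arcs. An antimagic labeling of a directed graph with $n$ vertices and $l$ arcs is a bijection $f$ from its arc set to $\{1,2,\dots,l\}$ such that the $n$ vertex sums are pairwise distinct, where the vertex sum of a vertex $v$ is $S_v=S_v^-+S_v^+$, with $S_v^-$ the sum of $f$ over all arcs entering $v$ and $S_v^+$ the sum of $f$ over all arcs leaving $v$. A directed graph is antimagic if it admits an antimagic labeling. *)

theory Defs
  imports "Graph_Theory.Digraph"
begin

definition vertex_sum :: "('a, 'b) pre_digraph \<Rightarrow> ('b \<Rightarrow> nat) \<Rightarrow> 'a \<Rightarrow> nat" where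
  "vertex_sum G f v = (\<Sum>e\<in>in_arcs G v. f e) + (\<Sum>e\<in>out_arcs G v. f e)"

(* Meaningful for finite digraphs; f is only constrained on the arcs of G. *)
definition antimagic_labeling :: "('a, 'b) pre_digraph \<Rightarrow> ('b \<Rightarrow> nat) \<Rightarrow> bool" where
  "antimagic_labeling G f \<longleftrightarrow>
     bij_betw f (arcs G) {1..card (arcs G)} \<and> inj_on (vertex_sum G f) (verts G)"

definition antimagic :: "('a, 'b) pre_digraph \<Rightarrow> bool" where
  "antimagic G \<longleftrightarrow> (\<exists>f. antimagic_labeling G f)"

(* The vertex v_i is represented by the number i, and the arc from v_i to v_j by the pair (i, j). *)
definition directed_K :: "nat \<Rightarrow> (nat, nat \<times> nat) pre_digraph" where
  "directed_K n =
     \<lparr> verts = {1..n}, arcs = {(i, j). 1 \<le> i \<and> i < j \<and> j \<le> n}, tail = fst, head = snd \<rparr>"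

lemma digraph_directed_K: "digraph (directed_K n)"
proof -
  have "finite {(i, j). 1 \<le> i \<and> i < j \<and> j \<le> n}"
    by (rule finite_subset[of _ "{1..n} \<times> {1..n}"]) auto
  then show ?thesis
    by unfold_locales (auto simp: directed_K_def arc_to_ends_def)
qed

lemma card_arcs_directed_K: "card (arcs (directed_K n)) = n choose 2"
proof (induction n)
  case 0
  have "arcs (directed_K 0) = {}" by (auto simp: directed_K_def)
  then show ?case by simp
next
  case (Suc n)
  let ?A = "arcs (directed_K n)" and ?B = "(\<lambda>i. (i, Suc n)) ` {1..n}"
  have "finite ?A"
    using digraph_directed_K[of n] by (simp add: digraph_def fin_digraph.finite_arcs)
  moreover have "arcs (directed_K (Suc n)) = ?A \<union> ?B" "?A \<inter> ?B = {}"
    by (auto simp: directed_K_def)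
  moreover have "card ?B = n"
    by (simp add: card_image inj_on_def)
  ultimately have "card (arcs (directed_K (Suc n))) = (n choose 2) + n"
    using Suc by (simp add: card_Un_disjoint)
  then show ?case by (simp add: numeral_2_eq_2)
qed

end

theory Submission
  imports Defs
begin

text \<open>Number the arcs by increasing head, and arcs with equal head by increasing tail.
  If \<open>v < w\<close>, then for every third vertex \<open>u\<close> the arc between \<open>u\<close> and \<open>v\<close> gets a smaller label
  than the arc between \<open>u\<close> and \<open>w\<close>, while the arc between \<open>v\<close> and \<open>w\<close> counts in both vertex sums.
  A third vertex exists as \<open>n \<ge> 3\<close>, so the vertex sums increase strictly with the vertex.\<close>

text \<open>The binomial offset counts the arcs with smaller head; tails start at 1, so labels do
  too.\<close>

definition colex_label :: "nat \<times> nat \<Rightarrow> nat" where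
  "colex_label e = (snd e - 1 choose 2) + fst e"

text \<open>The tail is at most \<open>j - 1\<close>, and Pascal's rule adds this to the
  offset.\<close>

lemma colex_label_le:
  assumes "i < j"
  shows "colex_label (i, j) \<le> j choose 2"
proof -
  obtain k where "j = Suc k" using assms by (cases j) auto
  then show ?thesis using assms by (simp add: colex_label_def numeral_2_eq_2)
qed

lemma colex_label_less_head:
  assumes "i < j" "j < l" "0 < k"
  shows "colex_label (i, j) < colex_label (k, l)"
proof -
  have "colex_label (i, j) \<le> j choose 2" by (rule colex_label_le) fact
  also have "\<dots> \<le> l - 1 choose 2" using assms by (intro binomial_right_mono) auto
  also have "\<dots> < colex_label (k, l)" using assms by (simp add: colex_label_def)
  finally show ?thesis .
qed

text \<open>Induction on \<open>n\<close>: the arcs into the new vertex \<open>Suc n\<close> take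
  exactly the next \<open>n\<close> labels.\<close>

lemma colex_label_image: "colex_label ` arcs (directed_K n) = {1..n choose 2}"
proof (induction n)
  case 0
  then show ?case by (auto simp: directed_K_def)
next
  case (Suc n)
  have "arcs (directed_K (Suc n)) = arcs (directed_K n) \<union> (\<lambda>i. (i, Suc n)) ` {1..n}"
    by (auto simp: directed_K_def)
  moreover have "colex_label ` (\<lambda>i. (i, Suc n)) ` {1..n} = (+) (n choose 2) ` {1..n}"
    by (simp add: image_image colex_label_def)
  ultimately have "colex_label ` arcs (directed_K (Suc n))
      = {1..n choose 2} \<union> {(n choose 2) + 1..(n choose 2) + n}"
    using Suc by (simp add: image_Un add.commute)
  then show ?case by (auto simp: numeral_2_eq_2)
qed

lemma bij_betw_colex_label:
  "bij_betw colex_label (arcs (directed_K n)) {1..card (arcs (directed_K n))}"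
proof -
  have "finite (arcs (directed_K n))"
    using digraph_directed_K[of n] by (simp add: digraph_def fin_digraph.finite_arcs)
  then show ?thesis
    unfolding bij_betw_def
    \<comment> \<open>Injectivity comes from counting: the image is as large as the finite arc
      set.\<close>
    by (auto simp: colex_label_image card_arcs_directed_K intro!: eq_card_imp_inj_on)
qed

text \<open>Exactly one arc joins \<open>v\<close> to each other vertex; writing it with
  \<open>min\<close> and \<open>max\<close> merges incoming and outgoing arcs into one sum.\<close>

lemma vertex_sum_directed_K:
  assumes "v \<in> {1..n}"
  shows "vertex_sum (directed_K n) f v = (\<Sum>u\<in>{1..n} - {v}. f (min u v, max u v))"
proof -
  have "in_arcs (directed_K n) v = (\<lambda>u. (u, v)) ` {1..<v}"
    using assms by (auto simp: in_arcs_def directed_K_def)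
  then have "sum f (in_arcs (directed_K n) v) = (\<Sum>u\<in>{1..<v}. f (min u v, max u v))"
    by (simp add: sum.reindex inj_on_def min_def max_def)
  moreover have "out_arcs (directed_K n) v = Pair v ` {v<..n}"
    using assms by (auto simp: out_arcs_def directed_K_def)
  then have "sum f (out_arcs (directed_K n) v) = (\<Sum>u\<in>{v<..n}. f (min u v, max u v))"
    by (simp add: sum.reindex inj_on_def min_def max_def)
  moreover have "{1..n} - {v} = {1..<v} \<union> {v<..n}" "{1..<v} \<inter> {v<..n} = {}"
    using assms by auto
  ultimately show ?thesis by (simp add: vertex_sum_def sum.union_disjoint)
qed

lemma colex_label_less_third:
  assumes "v < w" "u \<noteq> v" "u \<noteq> w" "0 < u" "0 < v"
  shows "colex_label (min u v, max u v) < colex_label (min u w, max u w)"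
\<comment> \<open>If \<open>w < u\<close>, both arcs have head \<open>u\<close> and the tails
  decide; otherwise the second arc has head \<open>w\<close>, beyond both \<open>u\<close> and
  \<open>v\<close>.\<close>
proof (cases "w < u")
  case True
  then show ?thesis using assms by (simp add: colex_label_def min_def max_def)
next
  case False
  then show ?thesis using assms by (intro colex_label_less_head) auto
qed

lemma vertex_sum_colex_label_less:
  assumes "n \<ge> 3" "v \<in> {1..n}" "w \<in> {1..n}" "v < w"
  shows "vertex_sum (directed_K n) colex_label v < vertex_sum (directed_K n) colex_label w"
proof -
  let ?g = "\<lambda>v u. colex_label (min u v, max u v)"
  let ?T = "{1..n} - {v, w}"
  \<comment> \<open>Splitting off the shared arc leaves two sums over the same index set.\<close>
  have T: "{1..n} - {v} = insert w ?T" "{1..n} - {w} = insert v ?T"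
    using assms by auto
  have "card ?T = n - 2" using assms by (simp add: card_Diff_subset)
  then have "card ?T \<noteq> 0" using assms(1) by linarith
  then have "?T \<noteq> {}" by (metis card.empty)
  then have "sum (?g v) ?T < sum (?g w) ?T"
    using assms by (intro sum_strict_mono colex_label_less_third) auto
  moreover have "?g v w = ?g w v" by (simp add: min.commute max.commute)
  ultimately have "sum (?g v) (insert w ?T) < sum (?g w) (insert v ?T)" by simp
  then show ?thesis
    by (simp only: vertex_sum_directed_K assms(2,3) T)
qed

theorem theorem2:
  fixes n :: nat
  assumes "n \<ge> 3"
  shows "antimagic (directed_K n)"
proof -
  have "inj_on (vertex_sum (directed_K n) colex_label) (verts (directed_K n))"
    using vertex_sum_colex_label_less[OF assms]
    by (intro linorder_inj_onI) (force simp: directed_K_def)+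
  then show ?thesis
    using bij_betw_colex_label by (auto simp: antimagic_def antimagic_labeling_def)
qed

end
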